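(* Let $\{X_i\}_{i\ge 1}$ be a Bernoulli sequence with random dependence (BSRD) with memory switch sequence $\{Y_i\}_{i\ge1}$, $\lambda_i=\mathbb{P}(Y_i=1)$, and with linear conditional probabilities $P_i(s,y)=\alpha_i+\beta_i\frac{sy}{i}$ for $i\ge 1$, $0\le s\le i$, $y\in\{0,1\}$, and $\mathbb{P}(X_1=1)=\alpha_0$. Let $S_n=X_1+\cdots+X_n$. Then $$\lim_{n\to\infty}\frac{S_n-\mathbb{E}(S_n)}{n}=0\quad\text{almost surely}$$ if and only if $$\sum_{k=1}^{\infty}\frac{1-\beta_k\lambda_k}{1+k}=\infty .$$
   Context: Linear BSRD. $\{X_i\}_{i\ge1}$ is a sequence of $\{0,1\}$-valued random variables, $S_i=X_1+\cdots+X_i$, and $\{Y_i\}_{i\ge1}$ (the memory switch sequence) is a sequence of independent $\{0,1\}$-valued random variables with $\mathbb{P}(Y_i=1)=\lambda_i\in[0,1]$, with $Y_i$ independent of $S_i$ for every $i\ge1$. Put $\mathcal{F}_i=\sigma(X_1,\dots,X_i)$ and $\mathcal{F}^Y_i=\sigma(Y_1,\dots,Y_i)$. The past enters only through $S_i$ and $Y_i$: $\mathbb{P}(X_{i+1}=1\mid\mathcal{F}_i,\mathcal{F}^Y_i)=\mathbb{P}(X_{i+1}=1\mid S_i,Y_i)$ and $\mathbb{P}(X_{i+1}=1\mid\mathcal{F}_i)=\mathbb{P}(X_{i+1}=1\mid S_i)$. Write $P_i(s,y)=\mathbb{P}(X_{i+1}=1\mid S_i=s,Y_i=y)$. In the linear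 BSRD, $P_i(s,y)=\alpha_i+\beta_i\frac{sy}{i}$ for all $i\ge1$, $0\le s\le i$, $y\in\{0,1\}$, and $\mathbb{P}(X_1=1)=\alpha_0\in[0,1]$, where $\{\alpha_i\}$, $\{\beta_i\}$ are deterministic real sequences with $\alpha_i\ge0$, $\beta_i\ge0$, $\alpha_i+\beta_i\le1$. (Consequently $\mathbb{P}(X_{i+1}=1\mid S_i=s)=\alpha_i+\lambda_i\beta_i\frac{s}{i}$.)
   Formalization: The formal theorem additionally assumes that some X_i has 0 < P(X_i = 1) < 1; without this the equivalence fails, e.g. for α_i = 0 for all i ≥ 0 and β_i = λ_i = 1, where X_i = 0 almost surely for all i but the series sums to 0. *)

theory Defs
  imports "HOL-Probability.Probability"
begin

definition generated_by :: "'a measure \<Rightarrow> ('a \<Rightarrow> real) set \<Rightarrow> 'a measure" where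
  "generated_by M fs = sigma (space M) (\<Union>f\<in>fs. {f -` A \<inter> space M | A. A \<in> sets borel})"

definition cond_probability :: "'a measure \<Rightarrow> 'a measure \<Rightarrow> ('a \<Rightarrow> bool) \<Rightarrow> 'a \<Rightarrow> real" where
  "cond_probability M F P = real_cond_exp M F (indicator {\<omega> \<in> space M. P \<omega>})"

definition partial_sum :: "(nat \<Rightarrow> 'a \<Rightarrow> real) \<Rightarrow> nat \<Rightarrow> 'a \<Rightarrow> real" where
  "partial_sum X n \<omega> = (\<Sum>i=1..n. X i \<omega>)"

text \<open>All sequences start at index 1; the values \<open>X 0\<close>, \<open>Y 0\<close>, \<open>lam 0\<close> are irrelevant.\<close>

locale BSRD = prob_space M
  for M :: "'a measure"
    and X :: "nat \<Rightarrow> 'a \<Rightarrow> real"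
    and Y :: "nat \<Rightarrow> 'a \<Rightarrow> real"
    and lam :: "nat \<Rightarrow> real" +
  assumes X_rv: "\<And>i. i \<ge> 1 \<Longrightarrow> random_variable borel (X i)"
    and X_01: "\<And>i \<omega>. i \<ge> 1 \<Longrightarrow> \<omega> \<in> space M \<Longrightarrow> X i \<omega> \<in> {0, 1}"
    and Y_rv: "\<And>i. i \<ge> 1 \<Longrightarrow> random_variable borel (Y i)"
    and Y_01: "\<And>i \<omega>. i \<ge> 1 \<Longrightarrow> \<omega> \<in> space M \<Longrightarrow> Y i \<omega> \<in> {0, 1}"
    and Y_prob: "\<And>i. i \<ge> 1 \<Longrightarrow> \<P>(\<omega> in M. Y i \<omega> = 1) = lam i"
    and Y_indep: "indep_vars (\<lambda>_. borel) Y {1..}"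
    and Y_indep_S: "\<And>i. i \<ge> 1 \<Longrightarrow> indep_var borel (Y i) borel (partial_sum X i)"
    and dependence_XY: "\<And>i. i \<ge> 1 \<Longrightarrow> AE \<omega> in M.
      cond_probability M (generated_by M (X ` {1..i} \<union> Y ` {1..i})) (\<lambda>\<omega>. X (i + 1) \<omega> = 1) \<omega> =
      cond_probability M (generated_by M {partial_sum X i, Y i}) (\<lambda>\<omega>. X (i + 1) \<omega> = 1) \<omega>"
    and dependence_X: "\<And>i. i \<ge> 1 \<Longrightarrow> AE \<omega> in M.
      cond_probability M (generated_by M (X ` {1..i})) (\<lambda>\<omega>. X (i + 1) \<omega> = 1) \<omega> =
      cond_probability M (generated_by M {partial_sum X i}) (\<lambda>\<omega>. X (i + 1) \<omega> = 1) \<omega>"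

text \<open>The formula for \<open>P\<^sub>i(s,y)\<close> is imposed only where the conditioning event is not null: the
  elementary conditional probability is undefined on null events (and 0 by convention here).\<close>

locale linear_BSRD = BSRD M X Y lam
  for M :: "'a measure"
    and X :: "nat \<Rightarrow> 'a \<Rightarrow> real"
    and Y :: "nat \<Rightarrow> 'a \<Rightarrow> real"
    and lam :: "nat \<Rightarrow> real" +
  fixes \<alpha> \<beta> :: "nat \<Rightarrow> real"
  assumes alpha_0: "0 \<le> \<alpha> 0" "\<alpha> 0 \<le> 1"
    and alpha_nonneg: "\<And>i. i \<ge> 1 \<Longrightarrow> 0 \<le> \<alpha> i"
    and beta_nonneg: "\<And>i. i \<ge> 1 \<Longrightarrow> 0 \<le> \<beta> i"
    and alpha_beta_le: "\<And>i. i \<ge> 1 \<Longrightarrow> \<alpha> i + \<beta> i \<le> 1"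
    and X_1: "\<P>(\<omega> in M. X 1 \<omega> = 1) = \<alpha> 0"
    and linear: "\<And>i s y. \<lbrakk>i \<ge> 1; s \<le> i; y \<in> {0, 1 :: nat};
        \<P>(\<omega> in M. partial_sum X i \<omega> = real s \<and> Y i \<omega> = real y) > 0\<rbrakk> \<Longrightarrow>
      \<P>(\<omega> in M. X (i + 1) \<omega> = 1 \<bar> partial_sum X i \<omega> = real s \<and> Y i \<omega> = real y) =
      \<alpha> i + \<beta> i * (real s * real y / real i)"

end

theory Submission
  imports Defs
begin

text \<open>
  Write \<open>S\<^sub>n\<close> for the partial sums, \<open>D\<^sub>n = S\<^sub>n - E S\<^sub>n\<close> and \<open>\<gamma>\<^sub>n = \<beta>\<^sub>n \<lambda>\<^sub>n\<close>. Averaging the linear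
  conditional probabilities over the memory switch, which is independent of \<open>S\<^sub>n\<close>, gives
  \<open>P(X\<^bsub>n+1\<^esub> = 1 | X\<^sub>1, \<dots>, X\<^sub>n) = \<alpha>\<^sub>n + \<gamma>\<^sub>n S\<^sub>n / n\<close> (lemma \<open>cond_probability_next\<close>). Hence
  \<open>Z\<^sub>n = D\<^sub>n / n\<close> satisfies the noisy linear recursion
    \<open>Z\<^bsub>n+1\<^esub> = r\<^sub>n Z\<^sub>n + \<epsilon>\<^sub>n / (n + 1)\<close>, where \<open>r\<^sub>n = (n + \<gamma>\<^sub>n) / (n + 1) = 1 - (1 - \<gamma>\<^sub>n) / (n + 1)\<close>,
  with a noise \<open>\<epsilon>\<^sub>n\<close> that is bounded by 1 and has conditional mean 0 given the past.

  The proof shows that four conditions are equivalent: \<open>Z\<^sub>n \<rightarrow> 0\<close> almost surely, \<open>E Z\<^sub>n\<^sup>2 \<rightarrow> 0\<close>,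
  \<open>r\<^sub>1 \<cdots> r\<^sub>n \<rightarrow> 0\<close>, and divergence of the series of the \<open>(1 - \<gamma>\<^sub>k) / (1 + k)\<close>. The last two are equivalent
  by comparing \<open>1 - t\<close> with exponentials. Since the noise is orthogonal to the past,
    \<open>r\<^sub>n\<^sup>2 E Z\<^sub>n\<^sup>2 \<le> E Z\<^bsub>n+1\<^esub>\<^sup>2 \<le> r\<^sub>n\<^sup>2 E Z\<^sub>n\<^sup>2 + 1 / (n + 1)\<^sup>2\<close>.
  The upper bound turns decay of the product into decay of \<open>E Z\<^sub>n\<^sup>2\<close>. The lower bound gives the converse
  as soon as some \<open>E Z\<^sub>m\<^sup>2\<close> is positive, and this is where nondegeneracy enters: if they all vanished, every
  \<open>X\<^sub>i\<close> would be almost surely constant.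

  Almost sure convergence implies convergence in mean square because \<open>|Z\<^sub>n| \<le> 1\<close>. For the other direction,
  the same second moment estimate holds on every event of the past, and
  \<open>1 / (n + 1)\<^sup>2 \<le> 1 / n - 1 / (n + 1)\<close>; so \<open>W\<^sub>n = Z\<^sub>n\<^sup>2 + 1 / n\<close> is a nonnegative supermartingale.
  Its mean tends to 0, and by the maximal inequality for nonnegative supermartingales so does \<open>W\<^sub>n\<close> itself,
  almost surely. Only the limit of the means enters here, not their rate, which is why the argument
  covers products that tend to 0 arbitrarily slowly.
\<close>

section \<open>Maximal inequality for nonnegative supermartingales\<close>

text \<open>Stop the process when it first reaches the level \<open>\<delta>\<close>. On \<open>low k\<close>, where it has not yet done
  so before time \<open>k\<close>, count \<open>W k\<close>; elsewhere count only \<open>\<delta>\<close>, a lower bound for the stopped value.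
  Stopping does not increase the mean, so the total stays below \<open>expectation (W m)\<close>.\<close>

lemma (in prob_space) supermartingale_maximal_inequality:
  fixes F :: "nat \<Rightarrow> 'a measure" and W :: "nat \<Rightarrow> 'a \<Rightarrow> real"
  assumes sub: "\<And>k. subalgebra M (F k)"
    and filt: "\<And>j k. j \<le> k \<Longrightarrow> sets (F j) \<subseteq> sets (F k)"
    and adapted: "\<And>k. W k \<in> borel_measurable (F k)"
    and integrable: "\<And>k. integrable M (W k)"
    and nonneg: "\<And>k \<omega>. 0 \<le> W k \<omega>"
    and super: "\<And>k A. m \<le> k \<Longrightarrow> A \<in> sets (F k) \<Longrightarrow>
      expectation (\<lambda>\<omega>. W (Suc k) \<omega> * indicator A \<omega>) \<le> expectation (\<lambda>\<omega>. W k \<omega> * indicator A \<omega>)"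
  shows "\<delta> * prob {\<omega> \<in> space M. \<exists>k\<ge>m. \<delta> \<le> W k \<omega>} \<le> expectation (W m)"
proof -
  define low where "low k = {\<omega> \<in> space M. \<forall>j\<in>{m..<k}. W j \<omega> < \<delta>}" for k
  have W_F: "W j \<in> borel_measurable (F k)" if "j \<le> k" for j k
    using adapted[of j] filt[OF that] sub[of j] sub[of k]
    by (auto simp: measurable_def subalgebra_def)
  have W_M [measurable]: "W j \<in> borel_measurable M" for j
    using integrable by auto
  have space_F: "space (F k) = space M" for k
    using sub[of k] by (simp add: subalgebra_def)
  have low_F: "low (Suc k) \<in> sets (F k)" for k
  proof -
    have "{\<omega> \<in> space (F k). \<forall>j\<in>{m..<Suc k}. W j \<omega> < \<delta>} \<in> sets (F k)"
    proof (rule sets.sets_Collect_finite_All)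
      fix j assume "j \<in> {m..<Suc k}"
      then have [measurable]: "W j \<in> borel_measurable (F k)" by (intro W_F) auto
      show "{\<omega> \<in> space (F k). W j \<omega> < \<delta>} \<in> sets (F k)" by measurable
    qed simp
    then show ?thesis by (simp add: low_def space_F)
  qed
  have low_M [measurable]: "low k \<in> events" for k
    unfolding low_def by measurable
  have int_W_ind [simp]: "integrable M (\<lambda>\<omega>. W j \<omega> * indicator (low k) \<omega>)" for j k
    using integrable_mult_indicator[OF low_M integrable] by (simp add: mult.commute)
  have int_ind [simp]: "integrable M (\<lambda>\<omega>. \<delta> * indicator (low k) \<omega>)" for k
    by (intro integrable_mult_right integrable_real_indicator low_M) (simp add: emeasure_eq_measure)
  have integral_indicator_events: "expectation (indicator (low k)) = prob (low k)" for k
    by simp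
  \<comment> \<open>\<open>low (Suc k)\<close> is already decided at time \<open>k\<close>, so the supermartingale property applies to it;
    paths that leave at time \<open>k\<close> trade their value \<open>W k \<ge> \<delta>\<close> for \<open>\<delta>\<close>.\<close>
  have stopped: "expectation (\<lambda>\<omega>. W k \<omega> * indicator (low k) \<omega>) + \<delta> * (1 - prob (low k))
      \<le> expectation (W m)" if "m \<le> k" for k
    using that
  proof (induction k rule: dec_induct)
    case base
    have "low m = space M" by (auto simp: low_def)
    then have "expectation (\<lambda>\<omega>. W m \<omega> * indicator (low m) \<omega>) = expectation (W m)"
      by (intro Bochner_Integration.integral_cong) auto
    then show ?case using \<open>low m = space M\<close> by (simp add: prob_space)
  next
    case (step k)
    have "expectation (\<lambda>\<omega>. W (Suc k) \<omega> * indicator (low (Suc k)) \<omega>)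
        \<le> expectation (\<lambda>\<omega>. W k \<omega> * indicator (low (Suc k)) \<omega>)"
      using step low_F by (intro super) auto
    moreover have "expectation (\<lambda>\<omega>. W k \<omega> * indicator (low (Suc k)) \<omega>
          + (\<delta> * indicator (low k) \<omega> - \<delta> * indicator (low (Suc k)) \<omega>))
        \<le> expectation (\<lambda>\<omega>. W k \<omega> * indicator (low k) \<omega>)"
    proof (rule integral_mono)
      fix \<omega> assume "\<omega> \<in> space M"
      then show "W k \<omega> * indicator (low (Suc k)) \<omega>
          + (\<delta> * indicator (low k) \<omega> - \<delta> * indicator (low (Suc k)) \<omega>)
        \<le> W k \<omega> * indicator (low k) \<omega>"
        using nonneg[of k \<omega>] step(1)
        by (auto simp: low_def indicator_def atLeastLessThanSuc)
    next
      show "integrable M (\<lambda>\<omega>. W k \<omega> * indicator (low (Suc k)) \<omega>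
          + (\<delta> * indicator (low k) \<omega> - \<delta> * indicator (low (Suc k)) \<omega>))"
        by (intro Bochner_Integration.integrable_add Bochner_Integration.integrable_diff
            int_W_ind int_ind)
    qed (rule int_W_ind)
    then have "expectation (\<lambda>\<omega>. W k \<omega> * indicator (low (Suc k)) \<omega>)
          + (\<delta> * prob (low k) - \<delta> * prob (low (Suc k)))
        \<le> expectation (\<lambda>\<omega>. W k \<omega> * indicator (low k) \<omega>)"
      by (simp only: Bochner_Integration.integral_add Bochner_Integration.integral_diff
          Bochner_Integration.integrable_diff int_W_ind int_ind integral_mult_right_zero
          integral_indicator_events)
    ultimately show ?case using step.IH by (simp add: algebra_simps)
  qed
  have bound: "\<delta> * (1 - prob (low k)) \<le> expectation (W m)" if "m \<le> k" for k
  proof -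
    have "0 \<le> expectation (\<lambda>\<omega>. W k \<omega> * indicator (low k) \<omega>)"
      using nonneg by (intro integral_nonneg_AE) auto
    then show ?thesis using stopped[OF that] by linarith
  qed
  have "(\<lambda>k. prob (low k)) \<longlonglongrightarrow> prob (\<Inter>k. low k)"
    by (rule finite_Lim_measure_decseq) (auto simp: decseq_def low_def)
  then have "(\<lambda>k. \<delta> * (1 - prob (low k))) \<longlonglongrightarrow> \<delta> * (1 - prob (\<Inter>k. low k))"
    by (intro tendsto_intros)
  then have "\<delta> * (1 - prob (\<Inter>k. low k)) \<le> expectation (W m)"
    by (rule LIMSEQ_le_const2) (use bound in blast)
  moreover have "{\<omega> \<in> space M. \<exists>k\<ge>m. \<delta> \<le> W k \<omega>} = space M - (\<Inter>k. low k)"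
  proof -
    have "(\<Inter>k. low k) = {\<omega> \<in> space M. \<forall>j\<ge>m. W j \<omega> < \<delta>}"
      unfolding low_def by (auto; metis atLeastLessThan_iff lessI)
    then show ?thesis by (auto simp: not_less)
  qed
  moreover have "(\<Inter>k. low k) \<in> events" by measurable
  ultimately show ?thesis by (simp add: prob_compl)
qed

text \<open>If the mean is small at time \<open>m\<close>, the maximal inequality makes it unlikely that the
  process ever exceeds a given level after \<open>m\<close>.\<close>

lemma (in prob_space) nonneg_supermartingale_tendsto_0:
  fixes F :: "nat \<Rightarrow> 'a measure" and W :: "nat \<Rightarrow> 'a \<Rightarrow> real"
  assumes sub: "\<And>k. subalgebra M (F k)"
    and filt: "\<And>j k. j \<le> k \<Longrightarrow> sets (F j) \<subseteq> sets (F k)"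
    and adapted: "\<And>k. W k \<in> borel_measurable (F k)"
    and integrable: "\<And>k. integrable M (W k)"
    and nonneg: "\<And>k \<omega>. 0 \<le> W k \<omega>"
    and super: "\<And>k A. N \<le> k \<Longrightarrow> A \<in> sets (F k) \<Longrightarrow>
      expectation (\<lambda>\<omega>. W (Suc k) \<omega> * indicator A \<omega>) \<le> expectation (\<lambda>\<omega>. W k \<omega> * indicator A \<omega>)"
    and mean: "(\<lambda>n. expectation (W n)) \<longlonglongrightarrow> 0"
  shows "AE \<omega> in M. (\<lambda>n. W n \<omega>) \<longlonglongrightarrow> 0"
proof -
  have W_M [measurable]: "W j \<in> borel_measurable M" for j
    using integrable by auto
  have small: "AE \<omega> in M. eventually (\<lambda>k. W k \<omega> < \<delta>) sequentially" if "\<delta> > 0" for \<delta>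
  proof -
    define bad where "bad = {\<omega> \<in> space M. \<forall>m. \<exists>k\<ge>m. \<delta> \<le> W k \<omega>}"
    have [measurable]: "bad \<in> events" unfolding bad_def by measurable
    have "\<delta> * prob bad \<le> expectation (W m)" if "N \<le> m" for m
    proof -
      have "prob bad \<le> prob {\<omega> \<in> space M. \<exists>k\<ge>m. \<delta> \<le> W k \<omega>}"
        by (rule finite_measure_mono) (auto simp: bad_def)
      then have "\<delta> * prob bad \<le> \<delta> * prob {\<omega> \<in> space M. \<exists>k\<ge>m. \<delta> \<le> W k \<omega>}"
        using \<open>\<delta> > 0\<close> by simp
      also have "\<dots> \<le> expectation (W m)"
        using that by (intro supermartingale_maximal_inequality[where F = F])
          (auto intro: sub adapted integrable nonneg super dest: filt)
      finally show ?thesis .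
    qed
    then have "\<delta> * prob bad \<le> 0"
      by (intro LIMSEQ_le_const[OF mean]) auto
    then have "prob bad = 0"
      using \<open>\<delta> > 0\<close> measure_nonneg[of M bad] by (simp add: mult_le_0_iff antisym)
    then have "AE \<omega> in M. \<omega> \<notin> bad"
      by (subst AE_iff_measurable[where N = bad]) (auto simp: emeasure_eq_measure bad_def)
    then show ?thesis
    proof (rule AE_mp, intro AE_I2 impI)
      fix \<omega> assume "\<omega> \<in> space M" "\<omega> \<notin> bad"
      then show "eventually (\<lambda>k. W k \<omega> < \<delta>) sequentially"
        unfolding bad_def eventually_sequentially by (auto simp: not_le) (metis not_le)
    qed
  qed
  have "AE \<omega> in M. \<forall>i. eventually (\<lambda>k. W k \<omega> < inverse (Suc i)) sequentially"
    by (subst AE_all_countable) (simp add: small)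
  then show ?thesis
  proof (rule AE_mp, intro AE_I2 impI)
    fix \<omega> assume *: "\<forall>i. eventually (\<lambda>k. W k \<omega> < inverse (Suc i)) sequentially"
    show "(\<lambda>n. W n \<omega>) \<longlonglongrightarrow> 0"
    proof (rule order_tendstoI)
      fix e :: real assume "0 < e"
      then obtain i where "inverse (Suc i) < e" using reals_Archimedean by blast
      then show "eventually (\<lambda>n. W n \<omega> < e) sequentially"
        by (intro eventually_mono[OF *[rule_format, of i]]) auto
    next
      fix e :: real assume "e < 0"
      then show "eventually (\<lambda>n. e < W n \<omega>) sequentially"
        using nonneg by (intro always_eventually allI) (rule less_le_trans)
    qed
  qed
qed

section \<open>Infinite products and their exponents\<close>

text \<open>This follows from \<open>exp (- 2 t) \<le> 1 - t \<le> exp (- t)\<close>; the lower bound relies on \<open>t \<le> 1/2\<close>.\<close>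

lemma prod_one_minus_tendsto_0_iff:
  fixes t :: "nat \<Rightarrow> real"
  assumes t: "\<And>k. k \<ge> 1 \<Longrightarrow> 0 \<le> t k" "\<And>k. k \<ge> 1 \<Longrightarrow> t k \<le> 1/2"
  shows "(\<lambda>n. \<Prod>k=1..n. 1 - t k) \<longlonglongrightarrow> 0 \<longleftrightarrow> filterlim (\<lambda>n. \<Sum>k=1..n. t k) at_top sequentially"
proof
  assume sum: "filterlim (\<lambda>n. \<Sum>k=1..n. t k) at_top sequentially"
  have "(\<lambda>n. exp (- (\<Sum>k=1..n. t k))) \<longlonglongrightarrow> 0"
    using sum by (intro filterlim_compose[OF exp_at_bot])
      (simp add: filterlim_uminus_at_bot)
  then show "(\<lambda>n. \<Prod>k=1..n. 1 - t k) \<longlonglongrightarrow> 0"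
  proof (rule real_tendsto_sandwich[OF _ _ tendsto_const[of 0], rotated 2]; intro always_eventually allI)
    fix n
    have "(\<Prod>k=1..n. 1 - t k) \<le> (\<Prod>k=1..n. exp (- t k))"
    proof (rule prod_mono, intro conjI)
      fix k assume "k \<in> {1..n}"
      then show "0 \<le> 1 - t k" using t(2)[of k] by auto
      show "1 - t k \<le> exp (- t k)" using exp_ge_add_one_self[of "- t k"] by simp
    qed
    also have "\<dots> = exp (\<Sum>k=1..n. - t k)"
      by (rule exp_sum[symmetric]) simp
    finally show "(\<Prod>k=1..n. 1 - t k) \<le> exp (- (\<Sum>k=1..n. t k))"
      by (simp only: sum_negf)
    show "0 \<le> (\<Prod>k=1..n. 1 - t k)"
    proof (rule prod_nonneg)
      fix k assume "k \<in> {1..n}"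
      then show "0 \<le> 1 - t k" using t(2)[of k] by auto
    qed
  qed
next
  assume prod: "(\<lambda>n. \<Prod>k=1..n. 1 - t k) \<longlonglongrightarrow> 0"
  have lower: "exp (- 2 * (\<Sum>k=1..n. t k)) \<le> (\<Prod>k=1..n. 1 - t k)" for n
  proof -
    have "(\<Prod>k=1..n. exp (- 2 * t k)) \<le> (\<Prod>k=1..n. 1 - t k)"
    proof (rule prod_mono, intro conjI)
      fix k assume "k \<in> {1..n}"
      then have k: "0 \<le> t k" "t k \<le> 1/2" using t by auto
      have "t k * t k \<le> t k * (1/2)" using k by (intro mult_left_mono) auto
      then have "- 2 * t k \<le> ln (1 - t k)"
        using ln_one_minus_pos_lower_bound[OF k] by (simp add: power2_eq_square)
      then have "exp (- 2 * t k) \<le> exp (ln (1 - t k))" by simp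
      then show "exp (- 2 * t k) \<le> 1 - t k" using k by simp
    qed simp
    then show ?thesis by (simp add: exp_sum sum_distrib_left flip: sum_negf)
  qed
  show "filterlim (\<lambda>n. \<Sum>k=1..n. t k) at_top sequentially"
    unfolding filterlim_at_top
  proof
    fix C :: real
    have "eventually (\<lambda>n. (\<Prod>k=1..n. 1 - t k) < exp (- 2 * C)) sequentially"
      by (rule order_tendstoD[OF prod]) simp
    then show "eventually (\<lambda>n. C \<le> (\<Sum>k=1..n. t k)) sequentially"
    proof (rule eventually_mono)
      fix n assume "(\<Prod>k=1..n. 1 - t k) < exp (- 2 * C)"
      then have "exp (- 2 * (\<Sum>k=1..n. t k)) < exp (- 2 * C)"
        using lower[of n] by linarith
      then show "C \<le> (\<Sum>k=1..n. t k)" by (simp only: exp_less_cancel_iff)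
    qed
  qed
qed

section \<open>The generated sigma-algebras\<close>

lemma space_generated_by [simp]: "space (generated_by M fs) = space M"
  by (simp add: generated_by_def space_measure_of_conv)

lemma sets_generated_by:
  "sets (generated_by M fs) =
    sigma_sets (space M) (\<Union>f\<in>fs. {f -` A \<inter> space M | A. A \<in> sets borel})"
  unfolding generated_by_def by (rule sets_measure_of) auto

lemma borel_measurable_generated_by:
  "f \<in> fs \<Longrightarrow> f \<in> borel_measurable (generated_by M fs)"
  by (intro measurableI) (auto simp: sets_generated_by intro!: sigma_sets.Basic)

lemma subalgebra_generated_by:
  assumes "\<And>f. f \<in> fs \<Longrightarrow> f \<in> borel_measurable M"
  shows "subalgebra M (generated_by M fs)"
proof -
  have "(\<Union>f\<in>fs. {f -` A \<inter> space M | A. A \<in> sets borel}) \<subseteq> sets M"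
    using assms by (auto intro: measurable_sets)
  then show ?thesis
    by (auto simp: subalgebra_def sets_generated_by dest: sets.sigma_sets_subset)
qed

lemma sets_generated_by_mono:
  "fs \<subseteq> gs \<Longrightarrow> sets (generated_by M fs) \<subseteq> sets (generated_by M gs)"
  unfolding sets_generated_by by (rule sigma_sets_mono') blast

lemma sets_generated_by_singleton:
  "sets (generated_by M {f}) = {f -` A \<inter> space M | A. A \<in> sets borel}"
  using sets_vimage_algebra2[of f "space M" borel]
  by (simp add: sets_generated_by sets_vimage_algebra)

section \<open>Elementary facts about the process\<close>

context linear_BSRD
begin

text \<open>The slope of the conditional mean of \<open>X (n + 1)\<close> as a function of \<open>S\<^sub>n / n\<close>, once the memory
  switch has been averaged out.\<close>

definition \<gamma> :: "nat \<Rightarrow> real" where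
  "\<gamma> n = \<beta> n * lam n"

definition past :: "nat \<Rightarrow> 'a measure" where
  "past n = generated_by M (X ` {1..n})"

definition dev :: "nat \<Rightarrow> 'a \<Rightarrow> real" where
  "dev n \<omega> = partial_sum X n \<omega> - expectation (partial_sum X n)"

lemma lam_bounds: "n \<ge> 1 \<Longrightarrow> 0 \<le> lam n" "n \<ge> 1 \<Longrightarrow> lam n \<le> 1"
  using Y_prob[of n] by (metis measure_nonneg, metis prob_le_1)

lemma \<gamma>_bounds:
  assumes "n \<ge> 1"
  shows "0 \<le> \<gamma> n" "\<alpha> n + \<gamma> n \<le> 1" "\<gamma> n \<le> 1"
proof -
  show "0 \<le> \<gamma> n" using assms beta_nonneg lam_bounds by (simp add: \<gamma>_def)
  have "\<gamma> n \<le> \<beta> n * 1"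
    unfolding \<gamma>_def using assms beta_nonneg lam_bounds by (intro mult_left_mono) auto
  then show "\<alpha> n + \<gamma> n \<le> 1" "\<gamma> n \<le> 1"
    using alpha_beta_le[of n] alpha_nonneg[of n] assms by auto
qed

lemma partial_sum_0: "partial_sum X 0 = (\<lambda>\<omega>. 0)"
  by (simp add: partial_sum_def fun_eq_iff)

lemma partial_sum_Suc: "partial_sum X (Suc n) \<omega> = partial_sum X n \<omega> + X (Suc n) \<omega>"
  by (simp add: partial_sum_def)

lemma X_measurable [measurable]: "X (Suc n) \<in> borel_measurable M"
  using X_rv[of "Suc n"] by simp

lemma partial_sum_measurable [measurable]: "partial_sum X n \<in> borel_measurable M"
  unfolding partial_sum_def[abs_def] by (intro borel_measurable_sum X_rv) auto

lemma subalgebra_past: "subalgebra M (past n)"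
  unfolding past_def by (rule subalgebra_generated_by) (auto intro: X_rv)

lemma past_mono: "m \<le> n \<Longrightarrow> sets (past m) \<subseteq> sets (past n)"
  unfolding past_def by (rule sets_generated_by_mono) auto

lemma partial_sum_past: "partial_sum X n \<in> borel_measurable (past n)"
  unfolding partial_sum_def[abs_def] past_def
  by (intro borel_measurable_sum borel_measurable_generated_by) auto

lemma X_cases: "\<omega> \<in> space M \<Longrightarrow> X (Suc n) \<omega> = 0 \<or> X (Suc n) \<omega> = 1"
  using X_01[of "Suc n" \<omega>] by auto

lemma partial_sum_nat: "\<omega> \<in> space M \<Longrightarrow> \<exists>s\<le>n. partial_sum X n \<omega> = real s"
proof (induction n)
  case (Suc n)
  then obtain s where "s \<le> n" "partial_sum X n \<omega> = real s" by blast
  with X_cases[OF Suc.prems, of n] show ?case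
    by (intro exI[of _ "if X (Suc n) \<omega> = 0 then s else Suc s"]) (auto simp: partial_sum_Suc)
qed (simp add: partial_sum_0)

lemma partial_sum_bounds:
  assumes "\<omega> \<in> space M"
  shows "0 \<le> partial_sum X n \<omega>" "partial_sum X n \<omega> \<le> real n"
  using partial_sum_nat[OF assms, of n] by auto

lemma integrable_X: "integrable M (X (Suc n))"
proof (rule integrable_const_bound[where B = 1])
  show "AE \<omega> in M. norm (X (Suc n) \<omega>) \<le> 1"
  proof (rule AE_I2)
    fix \<omega> assume "\<omega> \<in> space M"
    from X_cases[OF this, of n] show "norm (X (Suc n) \<omega>) \<le> 1" by auto
  qed
qed simp

lemma integrable_partial_sum: "integrable M (partial_sum X n)"
  by (rule integrable_const_bound[where B = "real n"]) (auto simp: partial_sum_bounds)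

section \<open>The conditional law of the next variable\<close>

text \<open>Split according to the value of \<open>Y n\<close>, which is independent of the partial sum. The linear
  formula is available only when the conditioning event has positive probability; on a null event both
  sides of the identity for that cell vanish.\<close>

lemma prob_next_and_partial_sum:
  assumes n: "n \<ge> 1" and s: "s \<le> n"
  shows "prob {\<omega> \<in> space M. X (Suc n) \<omega> = 1 \<and> partial_sum X n \<omega> = real s} =
    (\<alpha> n + \<gamma> n * (real s / real n)) * prob {\<omega> \<in> space M. partial_sum X n \<omega> = real s}"
proof -
  have [measurable]: "Y n \<in> borel_measurable M" using Y_rv n by auto
  define S where "S = {\<omega> \<in> space M. partial_sum X n \<omega> = real s}"
  define SY where "SY y = {\<omega> \<in> space M. partial_sum X n \<omega> = real s \<and> Y n \<omega> = real y}" for y :: nat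
  define XSY where "XSY y = {\<omega> \<in> space M. X (Suc n) \<omega> = 1 \<and> partial_sum X n \<omega> = real s \<and> Y n \<omega> = real y}"
    for y :: nat
  have [measurable]: "S \<in> events" "SY y \<in> events" "XSY y \<in> events" for y
    unfolding S_def SY_def XSY_def by measurable
  have XSY: "prob (XSY y) = (\<alpha> n + \<beta> n * (real s * real y / real n)) * prob (SY y)"
    if y: "y \<in> {0, 1}" for y
  proof (cases "prob (SY y) = 0")
    case True
    have "prob (XSY y) \<le> prob (SY y)"
      by (rule finite_measure_mono) (auto simp: XSY_def SY_def)
    then show ?thesis using True measure_nonneg[of M "XSY y"] by simp
  next
    case False
    then have "prob (SY y) > 0" using measure_nonneg[of M "SY y"] by linarith
    then show ?thesis
      using linear[OF n s y] False
      by (simp add: cond_prob_def XSY_def SY_def field_simps)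
  qed
  have SY1: "prob (SY 1) = lam n * prob S"
  proof -
    have "prob {\<omega> \<in> space M. Y n \<omega> \<in> {1} \<and> partial_sum X n \<omega> \<in> {real s}}
        = prob {\<omega> \<in> space M. Y n \<omega> \<in> {1}} * prob {\<omega> \<in> space M. partial_sum X n \<omega> \<in> {real s}}"
      by (rule prob_indep_random_variable[OF Y_indep_S[OF n]]) auto
    then show ?thesis
      using Y_prob[OF n] by (simp add: SY_def S_def conj_commute)
  qed
  have "prob S = prob (SY 0 \<union> SY 1)"
    using Y_01[OF n] by (intro arg_cong[where f = prob]) (auto simp: S_def SY_def)
  also have "\<dots> = prob (SY 0) + prob (SY 1)"
    by (rule finite_measure_Union) (auto simp: SY_def)
  finally have S: "prob S = prob (SY 0) + prob (SY 1)" .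
  have "prob {\<omega> \<in> space M. X (Suc n) \<omega> = 1 \<and> partial_sum X n \<omega> = real s} = prob (XSY 0 \<union> XSY 1)"
    using Y_01[OF n] by (intro arg_cong[where f = prob]) (auto simp: XSY_def)
  also have "\<dots> = prob (XSY 0) + prob (XSY 1)"
    by (rule finite_measure_Union) (auto simp: XSY_def)
  also have "\<dots> = \<alpha> n * prob S + \<beta> n * (real s / real n) * prob (SY 1)"
    using XSY[of 0] XSY[of 1] S by (simp add: algebra_simps)
  also have "\<dots> = (\<alpha> n + \<gamma> n * (real s / real n)) * prob S"
    unfolding SY1 by (simp add: \<gamma>_def algebra_simps)
  finally show ?thesis by (simp add: S_def)
qed

text \<open>A version of the conditional probability of \<open>X (n + 1) = 1\<close> given the past, for \<open>n \<ge> 1\<close>.\<close>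

definition drift :: "nat \<Rightarrow> 'a \<Rightarrow> real" where
  "drift n \<omega> = \<alpha> n + \<gamma> n * (partial_sum X n \<omega> / real n)"

lemma drift_bounds:
  assumes "n \<ge> 1" "\<omega> \<in> space M"
  shows "0 \<le> drift n \<omega>" "drift n \<omega> \<le> 1"
proof -
  have r: "0 \<le> partial_sum X n \<omega> / real n" "partial_sum X n \<omega> / real n \<le> 1"
    using partial_sum_bounds[OF assms(2), of n] assms(1) by auto
  then show "0 \<le> drift n \<omega>"
    unfolding drift_def using \<gamma>_bounds[OF assms(1)] alpha_nonneg[OF assms(1)]
    by (intro add_nonneg_nonneg mult_nonneg_nonneg)
  have "\<gamma> n * (partial_sum X n \<omega> / real n) \<le> \<gamma> n * 1"
    using r \<gamma>_bounds[OF assms(1)] by (intro mult_left_mono) auto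
  then show "drift n \<omega> \<le> 1"
    using \<gamma>_bounds[OF assms(1)] by (simp add: drift_def)
qed

lemma drift_measurable [measurable]: "drift n \<in> borel_measurable M"
  unfolding drift_def[abs_def] by measurable

lemma integrable_drift: "n \<ge> 1 \<Longrightarrow> integrable M (drift n)"
  by (rule integrable_const_bound[where B = 1]) (auto simp: drift_bounds)

text \<open>Conditioning on the past is the same as conditioning on \<open>S\<^sub>n\<close>, by hypothesis. As \<open>S\<^sub>n\<close> takes only
  the values \<open>0, \<dots>, n\<close>, the defining integral identity of the conditional expectation reduces to the
  cells \<open>S\<^sub>n = s\<close>, where it is \<open>prob_next_and_partial_sum\<close>.\<close>

lemma cond_probability_next:
  assumes n: "n \<ge> 1"
  shows "AE \<omega> in M. cond_probability M (past n) (\<lambda>\<omega>. X (Suc n) \<omega> = 1) \<omega> = drift n \<omega>"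
proof -
  let ?G = "generated_by M {partial_sum X n}"
  let ?E = "{\<omega> \<in> space M. X (Suc n) \<omega> = 1}"
  interpret G: finite_measure_subalgebra M ?G
    by unfold_locales (rule subalgebra_generated_by, simp)
  have E [measurable]: "?E \<in> events" by measurable
  have intE: "integrable M (indicator ?E :: 'a \<Rightarrow> real)"
    by (rule integrable_real_indicator[OF E]) (simp add: emeasure_eq_measure)
  have "AE \<omega> in M. real_cond_exp M ?G (indicator ?E) \<omega> = drift n \<omega>"
  proof (rule G.real_cond_exp_charact)
    fix A assume "A \<in> sets ?G"
    then obtain B where B [measurable]: "B \<in> sets borel" and A: "A = partial_sum X n -` B \<inter> space M"
      by (auto simp: sets_generated_by_singleton)
    define S where "S s = {\<omega> \<in> space M. partial_sum X n \<omega> = real s}" for s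
    have [measurable]: "S s \<in> events" for s unfolding S_def by measurable
    have split: "(LINT \<omega>:A|M. f \<omega>) = (\<Sum>s\<le>n. indicator B (real s) * expectation (\<lambda>\<omega>. indicator (S s) \<omega> * f \<omega>))"
      if f: "integrable M f" for f :: "'a \<Rightarrow> real"
    proof -
      have int: "integrable M (\<lambda>\<omega>. indicator (S s) \<omega> * f \<omega>)" for s
        using integrable_mult_indicator[OF _ f, of "S s"] by simp
      have "(LINT \<omega>:A|M. f \<omega>) =
        expectation (\<lambda>\<omega>. \<Sum>s\<le>n. indicator B (real s) * (indicator (S s) \<omega> * f \<omega>))"
        unfolding set_lebesgue_integral_def
      proof (rule Bochner_Integration.integral_cong)
        fix \<omega> assume \<omega>: "\<omega> \<in> space M"
        then obtain s where s: "s \<le> n" "partial_sum X n \<omega> = real s" using partial_sum_nat by blast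
        have "(\<Sum>s'\<le>n. indicator B (real s') * (indicator (S s') \<omega> * f \<omega>))
            = (\<Sum>s'\<le>n. if s' = s then indicator B (real s) * f \<omega> else 0)"
          using s \<omega> by (intro sum.cong) (auto simp: S_def)
        also have "\<dots> = indicator B (real s) * f \<omega>"
          using s(1) by simp
        also have "\<dots> = indicat_real A \<omega> *\<^sub>R f \<omega>"
          using s \<omega> by (simp add: A indicator_def)
        finally show "indicat_real A \<omega> *\<^sub>R f \<omega> = (\<Sum>s\<le>n. indicator B (real s) * (indicator (S s) \<omega> * f \<omega>))"
          by (rule sym)
      qed simp
      also have "\<dots> = (\<Sum>s\<le>n. indicator B (real s) * expectation (\<lambda>\<omega>. indicator (S s) \<omega> * f \<omega>))"
        by (simp only: Bochner_Integration.integral_sum integrable_mult_right int integral_mult_right_zero)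
      finally show ?thesis .
    qed
    have cell: "expectation (\<lambda>\<omega>. indicator (S s) \<omega> * indicator ?E \<omega>)
        = expectation (\<lambda>\<omega>. indicator (S s) \<omega> * drift n \<omega>)" if "s \<le> n" for s
    proof -
      have "expectation (\<lambda>\<omega>. indicator (S s) \<omega> * indicator ?E \<omega>)
          = prob {\<omega> \<in> space M. X (Suc n) \<omega> = 1 \<and> partial_sum X n \<omega> = real s}"
        by (subst Bochner_Integration.integral_cong[OF refl, where g =
              "indicator {\<omega> \<in> space M. X (Suc n) \<omega> = 1 \<and> partial_sum X n \<omega> = real s}"])
          (auto simp: S_def indicator_def)
      also have "\<dots> = (\<alpha> n + \<gamma> n * (real s / real n)) * prob (S s)"
        using prob_next_and_partial_sum[OF n that] by (simp add: S_def)
      also have "\<dots> = expectation (\<lambda>\<omega>. (\<alpha> n + \<gamma> n * (real s / real n)) * indicator (S s) \<omega>)"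
        by simp
      also have "\<dots> = expectation (\<lambda>\<omega>. indicator (S s) \<omega> * drift n \<omega>)"
        by (rule Bochner_Integration.integral_cong) (auto simp: S_def drift_def indicator_def)
      finally show ?thesis .
    qed
    show "(LINT \<omega>:A|M. indicator ?E \<omega>) = (LINT \<omega>:A|M. drift n \<omega>)"
      unfolding split[OF intE] split[OF integrable_drift[OF n]] by (intro sum.cong refl) (simp add: cell)
  next
    have [measurable]: "partial_sum X n \<in> borel_measurable ?G"
      by (rule borel_measurable_generated_by) simp
    show "drift n \<in> borel_measurable ?G" unfolding drift_def[abs_def] by measurable
  qed (rule intE integrable_drift[OF n])+
  with dependence_X[OF n] show ?thesis
    unfolding past_def cond_probability_def by eventually_elim simp
qed

text \<open>The form in which the conditional law is used: against a bounded test variable that is known at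
  time \<open>n\<close>, the next value may be replaced by its drift.\<close>

lemma expectation_past_times_next:
  assumes n: "n \<ge> 1"
    and U [measurable]: "U \<in> borel_measurable (past n)"
    and bound: "\<And>\<omega>. \<omega> \<in> space M \<Longrightarrow> \<bar>U \<omega>\<bar> \<le> C"
  shows "expectation (\<lambda>\<omega>. U \<omega> * X (Suc n) \<omega>) = expectation (\<lambda>\<omega>. U \<omega> * drift n \<omega>)"
proof -
  let ?E = "{\<omega> \<in> space M. X (Suc n) \<omega> = 1}"
  interpret P: finite_measure_subalgebra M "past n"
    by unfold_locales (rule subalgebra_past)
  have UM [measurable]: "U \<in> borel_measurable M"
    by (rule measurable_from_subalg[OF subalgebra_past U])
  have E [measurable]: "?E \<in> events" by measurable
  have "\<bar>U \<omega> * indicator ?E \<omega>\<bar> \<le> C" if "\<omega> \<in> space M" for \<omega>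
    using bound[OF that] abs_ge_zero[of "U \<omega>"] by (auto simp: indicator_def simp del: abs_ge_zero)
  then have int: "integrable M (\<lambda>\<omega>. U \<omega> * indicator ?E \<omega>)"
    by (intro integrable_const_bound[where B = C]) (auto simp del: abs_mult)
  have "expectation (\<lambda>\<omega>. U \<omega> * X (Suc n) \<omega>) = expectation (\<lambda>\<omega>. U \<omega> * indicator ?E \<omega>)"
    using X_cases by (intro Bochner_Integration.integral_cong) (fastforce simp: indicator_def)+
  also have "\<dots> = expectation (\<lambda>\<omega>. U \<omega> * real_cond_exp M (past n) (indicator ?E) \<omega>)"
    by (rule P.real_cond_exp_intg(2)[symmetric]) (use int in auto)
  also have "\<dots> = expectation (\<lambda>\<omega>. U \<omega> * drift n \<omega>)"
    using cond_probability_next[OF n]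
    by (intro integral_cong_AE) (auto simp: cond_probability_def)
  finally show ?thesis .
qed

section \<open>The martingale structure of the deviation\<close>

definition noise :: "nat \<Rightarrow> 'a \<Rightarrow> real" where
  "noise n \<omega> = X (Suc n) \<omega> - drift n \<omega>"

lemma dev_measurable [measurable]: "dev n \<in> borel_measurable M"
  unfolding dev_def[abs_def] by measurable

lemma dev_past: "dev n \<in> borel_measurable (past n)"
  unfolding dev_def[abs_def] using partial_sum_past[of n] by measurable

lemma noise_measurable [measurable]: "noise n \<in> borel_measurable M"
  unfolding noise_def[abs_def] by measurable

lemma abs_dev_le:
  assumes "\<omega> \<in> space M"
  shows "\<bar>dev n \<omega>\<bar> \<le> real n"
proof -
  have "expectation (partial_sum X n) \<le> expectation (\<lambda>_. real n)"
    by (rule integral_mono) (auto simp: integrable_partial_sum partial_sum_bounds)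
  then have "expectation (partial_sum X n) \<le> real n" by (simp add: prob_space)
  moreover have "0 \<le> expectation (partial_sum X n)"
    by (rule integral_nonneg_AE) (auto simp: partial_sum_bounds)
  ultimately show ?thesis
    using partial_sum_bounds[OF assms, of n] by (simp add: dev_def)
qed

lemma abs_noise_le: "n \<ge> 1 \<Longrightarrow> \<omega> \<in> space M \<Longrightarrow> \<bar>noise n \<omega>\<bar> \<le> 1"
  using X_cases[of \<omega> n] drift_bounds[of n \<omega>] by (auto simp: noise_def)

text \<open>The drift is affine in \<open>S\<^sub>n\<close>, so its own deviation from the mean is \<open>\<gamma> n / n\<close> times that of \<open>S\<^sub>n\<close>;
  the \<open>\<alpha> n\<close> cancel.\<close>

lemma dev_Suc:
  assumes n: "n \<ge> 1"
  shows "dev (Suc n) \<omega> = (1 + \<gamma> n / real n) * dev n \<omega> + noise n \<omega>"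
proof -
  have "expectation (X (Suc n)) = expectation (drift n)"
    using expectation_past_times_next[OF n, of "\<lambda>_. 1" 1] by simp
  also have "\<dots> = \<alpha> n + \<gamma> n * (expectation (partial_sum X n) / real n)"
    unfolding drift_def[abs_def] using integrable_partial_sum by (simp add: prob_space)
  finally have "expectation (partial_sum X (Suc n)) =
      expectation (partial_sum X n) + (\<alpha> n + \<gamma> n * (expectation (partial_sum X n) / real n))"
    unfolding partial_sum_Suc[abs_def] using integrable_partial_sum integrable_X by simp
  then show ?thesis
    by (simp add: dev_def noise_def drift_def partial_sum_Suc algebra_simps diff_divide_distrib add_divide_distrib)
qed

text \<open>The event \<open>A\<close> is carried along because the supermartingale property tests second moments
  on events of the past.\<close>

lemma noise_orthogonal:
  assumes n: "n \<ge> 1" and A: "A \<in> sets (past n)"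
  shows "expectation (\<lambda>\<omega>. (indicator A \<omega> * dev n \<omega>) * noise n \<omega>) = 0"
proof -
  have [measurable]: "A \<in> events"
    using A subalgebra_past[of n] by (auto simp: subalgebra_def)
  let ?U = "\<lambda>\<omega>. indicator A \<omega> * dev n \<omega>"
  have U: "?U \<in> borel_measurable (past n)"
    using A dev_past by measurable
  have bound: "\<bar>?U \<omega>\<bar> \<le> real n" if "\<omega> \<in> space M" for \<omega>
    using abs_dev_le[OF that, of n] by (auto simp: indicator_def)
  have int: "integrable M (\<lambda>\<omega>. ?U \<omega> * f \<omega>)"
    if "f \<in> borel_measurable M" and f: "\<And>\<omega>. \<omega> \<in> space M \<Longrightarrow> \<bar>f \<omega>\<bar> \<le> 1" for f
  proof (rule integrable_const_bound[where B = "real n * 1"])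
    have "\<bar>?U \<omega>\<bar> * \<bar>f \<omega>\<bar> \<le> real n * 1" if "\<omega> \<in> space M" for \<omega>
      using bound[OF that] f[OF that] by (intro mult_mono) auto
    then show "AE \<omega> in M. norm (?U \<omega> * f \<omega>) \<le> real n * 1"
      by (intro AE_I2) (simp only: real_norm_def abs_mult)
  qed (use that in measurable)
  have X1: "\<bar>X (Suc n) \<omega>\<bar> \<le> 1" if "\<omega> \<in> space M" for \<omega>
    using X_cases[OF that, of n] by auto
  have d1: "\<bar>drift n \<omega>\<bar> \<le> 1" if "\<omega> \<in> space M" for \<omega>
    using drift_bounds[OF n that] by auto
  have "expectation (\<lambda>\<omega>. ?U \<omega> * noise n \<omega>)
      = expectation (\<lambda>\<omega>. ?U \<omega> * X (Suc n) \<omega>) - expectation (\<lambda>\<omega>. ?U \<omega> * drift n \<omega>)"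
    unfolding noise_def right_diff_distrib
    by (rule Bochner_Integration.integral_diff[OF int int]) (auto intro: X1 d1)
  also have "\<dots> = 0"
    using expectation_past_times_next[OF n U bound] by simp
  finally show ?thesis .
qed

definition avg_dev :: "nat \<Rightarrow> 'a \<Rightarrow> real" where
  "avg_dev n \<omega> = dev n \<omega> / real n"

text \<open>The factor by which the conditional mean of \<open>avg_dev\<close> contracts in one step.\<close>

definition ratio :: "nat \<Rightarrow> real" where
  "ratio n = (real n + \<gamma> n) / (real n + 1)"

lemma avg_dev_measurable [measurable]: "avg_dev n \<in> borel_measurable M"
  unfolding avg_dev_def[abs_def] by measurable

lemma avg_dev_past: "avg_dev n \<in> borel_measurable (past n)"
  unfolding avg_dev_def[abs_def] using dev_past by measurable

lemma abs_avg_dev_le: "\<omega> \<in> space M \<Longrightarrow> \<bar>avg_dev n \<omega>\<bar> \<le> 1"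
  using abs_dev_le[of \<omega> n] by (cases "n = 0") (auto simp: avg_dev_def)

lemma ratio_bounds:
  assumes "n \<ge> 1"
  shows "0 < ratio n" "ratio n \<le> 1"
  using \<gamma>_bounds[OF assms] assms by (auto simp: ratio_def)

lemma ratio_eq: "ratio n = 1 - (1 - \<gamma> n) / (1 + real n)"
  by (simp add: ratio_def field_simps)

lemma avg_dev_Suc:
  assumes n: "n \<ge> 1"
  shows "avg_dev (Suc n) \<omega> = ratio n * avg_dev n \<omega> + noise n \<omega> / (real n + 1)"
proof -
  have "avg_dev (Suc n) \<omega> = ((1 + \<gamma> n / real n) * dev n \<omega> + noise n \<omega>) / (real n + 1)"
    unfolding avg_dev_def dev_Suc[OF n] by (simp add: add.commute)
  also have "(1 + \<gamma> n / real n) * dev n \<omega> = (real n + \<gamma> n) * avg_dev n \<omega>"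
    using n by (simp add: avg_dev_def field_simps)
  also have "((real n + \<gamma> n) * avg_dev n \<omega> + noise n \<omega>) / (real n + 1)
      = ratio n * avg_dev n \<omega> + noise n \<omega> / (real n + 1)"
    by (simp only: ratio_def add_divide_distrib[of "(real n + \<gamma> n) * avg_dev n \<omega>"] times_divide_eq_left)
  finally show ?thesis .
qed

lemma integrable_bounded_square:
  fixes f :: "'a \<Rightarrow> real"
  assumes [measurable]: "f \<in> borel_measurable M" "A \<in> events"
    and f: "\<And>\<omega>. \<omega> \<in> space M \<Longrightarrow> \<bar>f \<omega>\<bar> \<le> 1"
  shows "integrable M (\<lambda>\<omega>. (f \<omega>)\<^sup>2 * indicator A \<omega>)"
proof (rule integrable_const_bound[where B = 1])
  have "\<bar>(f \<omega>)\<^sup>2 * indicator A \<omega>\<bar> \<le> 1" if "\<omega> \<in> space M" for \<omega>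
    using f[OF that] by (auto simp: indicator_def abs_square_le_1)
  then show "AE \<omega> in M. norm ((f \<omega>)\<^sup>2 * indicator A \<omega>) \<le> 1"
    by (intro AE_I2) simp
qed measurable

text \<open>Expanding the square in the recursion of \<open>avg_dev_Suc\<close>, the mixed term vanishes by orthogonality.\<close>

lemma avg_dev_second_moment:
  assumes n: "n \<ge> 1" and A: "A \<in> sets (past n)"
  shows "expectation (\<lambda>\<omega>. (avg_dev (Suc n) \<omega>)\<^sup>2 * indicator A \<omega>) =
    (ratio n)\<^sup>2 * expectation (\<lambda>\<omega>. (avg_dev n \<omega>)\<^sup>2 * indicator A \<omega>)
      + expectation (\<lambda>\<omega>. (noise n \<omega>)\<^sup>2 * indicator A \<omega>) / (real n + 1)\<^sup>2"
proof -
  have [measurable]: "A \<in> events"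
    using A subalgebra_past[of n] by (auto simp: subalgebra_def)
  have intZ: "integrable M (\<lambda>\<omega>. (avg_dev n \<omega>)\<^sup>2 * indicator A \<omega>)"
    by (rule integrable_bounded_square) (auto simp: abs_avg_dev_le)
  have intN: "integrable M (\<lambda>\<omega>. (noise n \<omega>)\<^sup>2 * indicator A \<omega>)"
    by (rule integrable_bounded_square) (auto simp: abs_noise_le[OF n])
  define c where "c = 2 * ratio n / (real n * (real n + 1))"
  have intC: "integrable M (\<lambda>\<omega>. (indicator A \<omega> * dev n \<omega>) * noise n \<omega>)"
  proof (rule integrable_const_bound[where B = "real n * 1"])
    have "\<bar>indicator A \<omega> * dev n \<omega>\<bar> * \<bar>noise n \<omega>\<bar> \<le> real n * 1" if "\<omega> \<in> space M" for \<omega>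
      using abs_dev_le[OF that, of n] abs_noise_le[OF n that]
      by (intro mult_mono) (auto simp: indicator_def)
    then show "AE \<omega> in M. norm ((indicator A \<omega> * dev n \<omega>) * noise n \<omega>) \<le> real n * 1"
      by (intro AE_I2) (simp only: real_norm_def abs_mult)
  qed measurable
  have "(avg_dev (Suc n) \<omega>)\<^sup>2 * indicator A \<omega> =
      (ratio n)\<^sup>2 * ((avg_dev n \<omega>)\<^sup>2 * indicator A \<omega>) + c * ((indicator A \<omega> * dev n \<omega>) * noise n \<omega>)
      + ((noise n \<omega>)\<^sup>2 * indicator A \<omega>) / (real n + 1)\<^sup>2" for \<omega>
    unfolding avg_dev_Suc[OF n]
    using n by (simp add: c_def avg_dev_def power2_sum power_mult_distrib power_divide algebra_simps)
  then have "expectation (\<lambda>\<omega>. (avg_dev (Suc n) \<omega>)\<^sup>2 * indicator A \<omega>) =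
      (ratio n)\<^sup>2 * expectation (\<lambda>\<omega>. (avg_dev n \<omega>)\<^sup>2 * indicator A \<omega>)
      + c * expectation (\<lambda>\<omega>. (indicator A \<omega> * dev n \<omega>) * noise n \<omega>)
      + expectation (\<lambda>\<omega>. (noise n \<omega>)\<^sup>2 * indicator A \<omega>) / (real n + 1)\<^sup>2"
    using intZ intN intC by simp
  then show ?thesis
    using noise_orthogonal[OF n A] by simp
qed

text \<open>The noise contributes at most \<open>1 / (n + 1)\<^sup>2\<close>. It is bounded by a telescoping difference,
  so that its accumulated effect from time \<open>m\<close> on is at most \<open>1 / m\<close> and can be absorbed into the
  compensator \<open>1 / n\<close> of a supermartingale.\<close>

lemma avg_dev_second_moment_le:
  assumes n: "n \<ge> 1" and A: "A \<in> sets (past n)"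
  shows "expectation (\<lambda>\<omega>. (avg_dev (Suc n) \<omega>)\<^sup>2 * indicator A \<omega>) \<le>
    (ratio n)\<^sup>2 * expectation (\<lambda>\<omega>. (avg_dev n \<omega>)\<^sup>2 * indicator A \<omega>)
      + (1 / real n - 1 / real (Suc n)) * prob A"
proof -
  have AM [measurable]: "A \<in> events"
    using A subalgebra_past[of n] by (auto simp: subalgebra_def)
  have "expectation (\<lambda>\<omega>. (noise n \<omega>)\<^sup>2 * indicator A \<omega>) \<le> expectation (indicator A)"
  proof (rule integral_mono)
    show "integrable M (\<lambda>\<omega>. (noise n \<omega>)\<^sup>2 * indicator A \<omega>)"
      by (rule integrable_bounded_square) (auto simp: abs_noise_le[OF n])
    show "(noise n \<omega>)\<^sup>2 * indicator A \<omega> \<le> indicator A \<omega>" if "\<omega> \<in> space M" for \<omega>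
      using abs_noise_le[OF n that] by (auto simp: indicator_def abs_square_le_1)
  qed (simp add: emeasure_eq_measure)
  then have "expectation (\<lambda>\<omega>. (noise n \<omega>)\<^sup>2 * indicator A \<omega>) / (real n + 1)\<^sup>2
      \<le> prob A / (real n + 1)\<^sup>2"
    by (intro divide_right_mono) auto
  also have "\<dots> = 1 / (real n + 1)\<^sup>2 * prob A" by simp
  also have "\<dots> \<le> (1 / real n - 1 / real (Suc n)) * prob A"
  proof (rule mult_right_mono)
    have "1 / (real n + 1)\<^sup>2 \<le> 1 / (real n * (real n + 1))"
      using n by (intro divide_left_mono) (auto simp: power2_eq_square)
    also have "\<dots> = 1 / real n - 1 / real (Suc n)"
      using n by (simp add: field_simps)
    finally show "1 / (real n + 1)\<^sup>2 \<le> 1 / real n - 1 / real (Suc n)" .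
  qed simp
  finally show ?thesis
    using avg_dev_second_moment[OF n A] by simp
qed

section \<open>Decay of the mean square\<close>

definition meansq :: "nat \<Rightarrow> real" where
  "meansq n = expectation (\<lambda>\<omega>. (avg_dev n \<omega>)\<^sup>2)"

definition decay :: "nat \<Rightarrow> real" where
  "decay n = (\<Prod>k=1..<n. ratio k)"

lemma decay_Suc: "n \<ge> 1 \<Longrightarrow> decay (Suc n) = decay n * ratio n"
  by (simp add: decay_def)

lemma decay_pos: "0 < decay n"
  unfolding decay_def by (rule prod_pos) (auto intro: ratio_bounds)

lemma meansq_nonneg: "0 \<le> meansq n"
  unfolding meansq_def by simp

lemma expectation_indicator_space:
  "expectation (\<lambda>\<omega>. f \<omega> * indicator (space M) \<omega>) = expectation f" for f :: "'a \<Rightarrow> real"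
  by (rule Bochner_Integration.integral_cong) auto

lemma space_past: "space M \<in> sets (past n)"
  using sets.top[of "past n"] by (simp add: past_def)

lemma meansq_Suc_ge:
  assumes n: "n \<ge> 1"
  shows "(ratio n)\<^sup>2 * meansq n \<le> meansq (Suc n)"
proof -
  have "0 \<le> expectation (\<lambda>\<omega>. (noise n \<omega>)\<^sup>2) / (real n + 1)\<^sup>2"
    by (intro divide_nonneg_nonneg integral_nonneg) auto
  then show ?thesis
    using avg_dev_second_moment[OF n space_past]
    by (simp add: meansq_def expectation_indicator_space)
qed

lemma meansq_Suc_le:
  assumes n: "n \<ge> 1"
  shows "meansq (Suc n) \<le> (ratio n)\<^sup>2 * meansq n + (1 / real n - 1 / real (Suc n))"
  using avg_dev_second_moment_le[OF n space_past]
  by (simp add: meansq_def expectation_indicator_space prob_space)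

lemma meansq_ge:
  assumes "m \<ge> 1" "m \<le> n"
  shows "(decay n / decay m)\<^sup>2 * meansq m \<le> meansq n"
  using assms(2)
proof (induction n rule: dec_induct)
  case base
  show ?case using decay_pos[of m] by simp
next
  case (step n)
  have n: "n \<ge> 1" using step assms by simp
  have "(decay (Suc n) / decay m)\<^sup>2 * meansq m = (ratio n)\<^sup>2 * ((decay n / decay m)\<^sup>2 * meansq m)"
    by (simp add: decay_Suc[OF n] power_mult_distrib power_divide)
  also have "\<dots> \<le> (ratio n)\<^sup>2 * meansq n"
    by (intro mult_left_mono step.IH) simp
  also have "\<dots> \<le> meansq (Suc n)" by (rule meansq_Suc_ge[OF n])
  finally show ?case .
qed

lemma meansq_le:
  assumes "m \<ge> 1" "m \<le> n"
  shows "meansq n \<le> (decay n / decay m)\<^sup>2 * meansq m + (1 / real m - 1 / real n)"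
  using assms(2)
proof (induction n rule: dec_induct)
  case base
  show ?case using decay_pos[of m] by simp
next
  case (step n)
  have n: "n \<ge> 1" using step assms by simp
  have r: "(ratio n)\<^sup>2 \<le> 1"
    using ratio_bounds[OF n] by (simp add: abs_square_le_1)
  have d: "0 \<le> 1 / real m - 1 / real n"
    using assms step n by (simp add: frac_le)
  have "meansq (Suc n) \<le> (ratio n)\<^sup>2 * meansq n + (1 / real n - 1 / real (Suc n))"
    by (rule meansq_Suc_le[OF n])
  also have "(ratio n)\<^sup>2 * meansq n
      \<le> (ratio n)\<^sup>2 * ((decay n / decay m)\<^sup>2 * meansq m + (1 / real m - 1 / real n))"
    by (intro mult_left_mono step.IH) simp
  also have "\<dots> \<le> (ratio n)\<^sup>2 * ((decay n / decay m)\<^sup>2 * meansq m) + (1 / real m - 1 / real n)"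
    using mult_right_mono[OF r d] by (simp add: distrib_left)
  also have "(ratio n)\<^sup>2 * ((decay n / decay m)\<^sup>2 * meansq m) = (decay (Suc n) / decay m)\<^sup>2 * meansq m"
    by (simp add: decay_Suc[OF n] power_mult_distrib power_divide)
  finally show ?case by simp
qed

lemma decay_tendsto_0_iff:
  "decay \<longlonglongrightarrow> 0 \<longleftrightarrow> filterlim (\<lambda>n. \<Sum>k=1..n. (1 - \<gamma> k) / (1 + real k)) at_top sequentially"
proof -
  have "decay \<longlonglongrightarrow> 0 \<longleftrightarrow> (\<lambda>n. decay (Suc n)) \<longlonglongrightarrow> 0"
    by (simp add: filterlim_sequentially_Suc)
  also have "(\<lambda>n. decay (Suc n)) = (\<lambda>n. \<Prod>k=1..n. 1 - (1 - \<gamma> k) / (1 + real k))"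
    by (simp only: decay_def ratio_eq atLeastLessThanSuc_atLeastAtMost)
  also have "(\<dots> \<longlonglongrightarrow> 0) \<longleftrightarrow>
      filterlim (\<lambda>n. \<Sum>k=1..n. (1 - \<gamma> k) / (1 + real k)) at_top sequentially"
  proof (rule prod_one_minus_tendsto_0_iff)
    fix k :: nat assume k: "k \<ge> 1"
    show "0 \<le> (1 - \<gamma> k) / (1 + real k)" "(1 - \<gamma> k) / (1 + real k) \<le> 1/2"
      using \<gamma>_bounds[OF k] k by (auto simp: field_simps)
  qed
  finally show ?thesis .
qed

text \<open>Start the iterated upper bound at a time \<open>m\<close> so late that the noise added afterwards is
  negligible; the contribution of the initial value \<open>meansq m\<close> is then killed by the product.\<close>

lemma meansq_tendsto_0:
  assumes "decay \<longlonglongrightarrow> 0"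
  shows "meansq \<longlonglongrightarrow> 0"
proof (rule order_tendstoI)
  fix e :: real assume "0 < e"
  obtain i where i: "inverse (real (Suc i)) < e / 2"
    using reals_Archimedean[of "e / 2"] \<open>0 < e\<close> by auto
  define m where "m = Suc i"
  have "(\<lambda>n. (decay n / decay m)\<^sup>2 * meansq m) \<longlonglongrightarrow> (0 / decay m)\<^sup>2 * meansq m"
    using decay_pos[of m] by (intro tendsto_intros assms) auto
  then have "eventually (\<lambda>n. (decay n / decay m)\<^sup>2 * meansq m < e / 2) sequentially"
    using \<open>0 < e\<close> by (intro order_tendstoD) auto
  with eventually_ge_at_top[of m] show "eventually (\<lambda>n. meansq n < e) sequentially"
  proof eventually_elim
    case (elim n)
    have "meansq n \<le> (decay n / decay m)\<^sup>2 * meansq m + (1 / real m - 1 / real n)"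
      using elim by (intro meansq_le) (auto simp: m_def)
    moreover have "1 / real m < e / 2" "0 \<le> 1 / real n"
      using i by (auto simp: m_def inverse_eq_divide)
    ultimately show ?case using elim by linarith
  qed
next
  fix e :: real assume "e < 0"
  then show "eventually (\<lambda>n. e < meansq n) sequentially"
    using meansq_nonneg by (intro always_eventually allI) (rule less_le_trans)
qed

text \<open>By the iterated lower bound, a positive mean square can disappear only through the product.\<close>

lemma decay_tendsto_0:
  assumes "meansq \<longlonglongrightarrow> 0" and m: "m \<ge> 1" "0 < meansq m"
  shows "decay \<longlonglongrightarrow> 0"
proof -
  have "(\<lambda>n. meansq n * ((decay m)\<^sup>2 / meansq m)) \<longlonglongrightarrow> 0"
    by (rule tendsto_mult_left_zero[OF assms(1)])
  then have "(\<lambda>n. (decay n)\<^sup>2) \<longlonglongrightarrow> 0"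
  proof (rule real_tendsto_sandwich[OF _ _ tendsto_const[of 0], rotated 2])
    show "eventually (\<lambda>n. (decay n)\<^sup>2 \<le> meansq n * ((decay m)\<^sup>2 / meansq m)) sequentially"
      using eventually_ge_at_top[of m]
    proof eventually_elim
      case (elim n)
      then show ?case
        using meansq_ge[OF m(1) elim] m(2) decay_pos[of m]
        by (simp add: power_divide field_simps)
    qed
  qed simp
  then show ?thesis by simp
qed

section \<open>Almost sure convergence and mean square convergence\<close>

text \<open>Adding \<open>1 / n\<close> to the squared average turns it into a supermartingale, since the noise of each
  step costs no more than the decrease of \<open>1 / n\<close>. The one-step inequality needs \<open>n \<ge> 1\<close>: the model
  gives the transition from \<open>X n\<close> to \<open>X (n + 1)\<close> only from there on.\<close>

lemma AE_avg_dev_tendsto_0: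
  assumes "meansq \<longlonglongrightarrow> 0"
  shows "AE \<omega> in M. (\<lambda>n. avg_dev n \<omega>) \<longlonglongrightarrow> 0"
proof -
  define W where "W n \<omega> = (avg_dev n \<omega>)\<^sup>2 + 1 / real n" for n \<omega>
  have intZ: "integrable M (\<lambda>\<omega>. (avg_dev n \<omega>)\<^sup>2 * indicator A \<omega>)" if "A \<in> events" for n A
    using that by (intro integrable_bounded_square) (auto simp: abs_avg_dev_le)
  have intZ': "integrable M (\<lambda>\<omega>. (avg_dev n \<omega>)\<^sup>2)" for n
    by (rule integrable_const_bound[where B = 1]) (auto simp: abs_avg_dev_le abs_square_le_1)
  have expW: "expectation (\<lambda>\<omega>. W n \<omega> * indicator A \<omega>) =
      expectation (\<lambda>\<omega>. (avg_dev n \<omega>)\<^sup>2 * indicator A \<omega>) + 1 / real n * prob A" if [measurable]: "A \<in> events" for n A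
  proof -
    have "expectation (\<lambda>\<omega>. W n \<omega> * indicator A \<omega>) =
        expectation (\<lambda>\<omega>. (avg_dev n \<omega>)\<^sup>2 * indicator A \<omega> + 1 / real n * indicator A \<omega>)"
      by (simp only: W_def distrib_right)
    also have "\<dots> = expectation (\<lambda>\<omega>. (avg_dev n \<omega>)\<^sup>2 * indicator A \<omega>) + expectation (\<lambda>\<omega>. 1 / real n * indicator A \<omega>)"
      by (rule Bochner_Integration.integral_add)
        (auto intro!: intZ integrable_mult_right integrable_real_indicator simp: emeasure_eq_measure)
    finally show ?thesis by simp
  qed
  have "AE \<omega> in M. (\<lambda>n. W n \<omega>) \<longlonglongrightarrow> 0"
  proof (rule nonneg_supermartingale_tendsto_0[where F = past and N = 1])
    show "W k \<in> borel_measurable (past k)" for k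
      unfolding W_def[abs_def] using avg_dev_past by measurable
    show "integrable M (W k)" for k
      unfolding W_def[abs_def] using intZ' by simp
    show "0 \<le> W k \<omega>" for k \<omega>
      by (simp add: W_def)
    show "expectation (\<lambda>\<omega>. W (Suc k) \<omega> * indicator A \<omega>) \<le> expectation (\<lambda>\<omega>. W k \<omega> * indicator A \<omega>)"
      if k: "1 \<le> k" and A: "A \<in> sets (past k)" for k A
    proof -
      have AM: "A \<in> events"
        using A subalgebra_past[of k] by (auto simp: subalgebra_def)
      have "(ratio k)\<^sup>2 * expectation (\<lambda>\<omega>. (avg_dev k \<omega>)\<^sup>2 * indicator A \<omega>)
          \<le> 1 * expectation (\<lambda>\<omega>. (avg_dev k \<omega>)\<^sup>2 * indicator A \<omega>)"
        using ratio_bounds[OF k]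
        by (intro mult_right_mono integral_nonneg) (auto simp: abs_square_le_1)
      then show ?thesis
        using avg_dev_second_moment_le[OF k A] by (simp only: expW[OF AM]) (simp add: algebra_simps)
    qed
    have "(\<lambda>n. meansq n + 1 / real n) \<longlonglongrightarrow> 0 + 0"
      by (intro tendsto_add assms lim_1_over_n)
    moreover have "expectation (W n) = meansq n + 1 / real n" for n
      unfolding W_def[abs_def] meansq_def using intZ' by (simp add: prob_space)
    ultimately show "(\<lambda>n. expectation (W n)) \<longlonglongrightarrow> 0" by simp
  qed (auto simp: subalgebra_past dest: past_mono)
  then show ?thesis
  proof eventually_elim
    case (elim \<omega>)
    have "(\<lambda>n. (avg_dev n \<omega>)\<^sup>2) \<longlonglongrightarrow> 0"
      by (rule real_tendsto_sandwich[OF _ _ tendsto_const[of 0] elim]) (auto simp: W_def)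
    then show ?case by simp
  qed
qed

lemma meansq_tendsto_0_of_AE:
  assumes "AE \<omega> in M. (\<lambda>n. avg_dev n \<omega>) \<longlonglongrightarrow> 0"
  shows "meansq \<longlonglongrightarrow> 0"
proof -
  have "(\<lambda>n. expectation (\<lambda>\<omega>. (avg_dev n \<omega>)\<^sup>2)) \<longlonglongrightarrow> expectation (\<lambda>_. 0)"
  proof (rule integral_dominated_convergence[where w = "\<lambda>_. 1"])
    show "AE \<omega> in M. (\<lambda>n. (avg_dev n \<omega>)\<^sup>2) \<longlonglongrightarrow> 0"
      using assms by eventually_elim simp
    show "AE \<omega> in M. norm ((avg_dev n \<omega>)\<^sup>2) \<le> 1" for n
      by (intro AE_I2) (simp add: abs_avg_dev_le abs_square_le_1)
  qed auto
  then show ?thesis by (simp add: meansq_def[abs_def])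
qed

text \<open>If no deviation ever had positive variance, every \<open>X i\<close>, as a difference of consecutive
  partial sums, would be almost surely constant.\<close>

lemma ex_meansq_pos:
  assumes "i \<ge> 1" "0 < prob {\<omega> \<in> space M. X i \<omega> = 1}" "prob {\<omega> \<in> space M. X i \<omega> = 1} < 1"
  shows "\<exists>m\<ge>1. 0 < meansq m"
proof (rule ccontr)
  assume "\<not> ?thesis"
  then have zero: "meansq m = 0" if "m \<ge> 1" for m
    using that meansq_nonneg[of m] by force
  have dev0: "AE \<omega> in M. dev m \<omega> = 0" for m
  proof (cases "m = 0")
    case True
    then show ?thesis by (simp add: dev_def partial_sum_0)
  next
    case False
    have "integrable M (\<lambda>\<omega>. (avg_dev m \<omega>)\<^sup>2)"
      by (rule integrable_const_bound[where B = 1]) (auto simp: abs_avg_dev_le abs_square_le_1)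
    then have "AE \<omega> in M. (avg_dev m \<omega>)\<^sup>2 = 0"
      using zero[of m] False integral_nonneg_eq_0_iff_AE[of M "\<lambda>\<omega>. (avg_dev m \<omega>)\<^sup>2"]
      by (simp add: meansq_def)
    then show ?thesis
      by eventually_elim (use False in \<open>simp add: avg_dev_def\<close>)
  qed
  obtain j where j: "i = Suc j" using assms(1) by (cases i) auto
  define c where "c = expectation (partial_sum X (Suc j)) - expectation (partial_sum X j)"
  have const: "AE \<omega> in M. X (Suc j) \<omega> = c"
    using dev0[of j] dev0[of "Suc j"]
    by eventually_elim (simp add: dev_def partial_sum_Suc c_def)
  show False
  proof (cases "c = 1")
    case True
    then have "prob {\<omega> \<in> space M. X i \<omega> = 1} = 1"
      using const j by (subst prob_Collect_eq_1) auto
    then show False using assms by simp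
  next
    case False
    have "AE \<omega> in M. X i \<omega> \<noteq> 1"
      using const by eventually_elim (use False j in auto)
    then have "prob {\<omega> \<in> space M. X i \<omega> = 1} = 0"
      using j by (subst prob_Collect_eq_0) auto
    then show False using assms by simp
  qed
qed

end

theorem theorem1:
  fixes M :: "'a measure"
    and X Y :: "nat \<Rightarrow> 'a \<Rightarrow> real"
    and lam \<alpha> \<beta> :: "nat \<Rightarrow> real"
  assumes "linear_BSRD M X Y lam \<alpha> \<beta>"
    and nondegenerate:
      "\<exists>i\<ge>1. 0 < \<P>(\<omega> in M. X i \<omega> = 1) \<and> \<P>(\<omega> in M. X i \<omega> = 1) < 1"
  shows "(AE \<omega> in M. (\<lambda>n. (partial_sum X n \<omega> - integral\<^sup>L M (partial_sum X n)) / real n)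
            \<longlonglongrightarrow> 0) \<longleftrightarrow>
         filterlim (\<lambda>n. \<Sum>k=1..n. (1 - \<beta> k * lam k) / (1 + real k)) at_top sequentially"
proof -
  interpret linear_BSRD M X Y lam \<alpha> \<beta> by fact
  obtain m where m: "m \<ge> 1" "0 < meansq m"
    using nondegenerate ex_meansq_pos by blast
  have "(AE \<omega> in M. (\<lambda>n. avg_dev n \<omega>) \<longlonglongrightarrow> 0) \<longleftrightarrow> decay \<longlonglongrightarrow> 0"
    using AE_avg_dev_tendsto_0 meansq_tendsto_0_of_AE meansq_tendsto_0 decay_tendsto_0[OF _ m] by blast
  then show ?thesis
    by (simp only: decay_tendsto_0_iff avg_dev_def dev_def \<gamma>_def)
qed

end
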